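(* Let $n$ be a positive integer. The complex $q$-binomial $$(z+iw)_q^n\equiv(z+iw)(z+iqw)(z+iq^2w)\cdots(z+iq^{n-1}w)=\sum_{k=0}^n{n\brack k}_q q^{k(k-1)/2}\,i^k z^{n-k}w^k,$$ as a function of the complex variables $z$ and $w$, satisfies $$\frac12\left(D_q^z+iD_{\frac1q}^w\right)(z+iw)_q^n=0$$ (that is, it is double $q$-analytic), and $$\frac12\left(D_q^z-iD_{\frac1q}^w\right)(z+iw)_q^n=[n]_q\,(z+iw)_q^{n-1}.$$
   Context: Here $q$ is the deformation parameter, $i$ is the imaginary unit, $[n]_q=\frac{q^n-1}{q-1}$, $[n]_q!=[1]_q[2]_q\cdots[n]_q$ (with $[0]_q!=1$), ${n\brack k}_q=\frac{[n]_q!}{[k]_q!\,[n-k]_q!}$, and $(z+iw)_q^0=1$. The $q$-derivatives are $$D_q^z f(z,w)=\frac{f(qz,w)-f(z,w)}{(q-1)z},\qquad D_{\frac1q}^w f(z,w)=\frac{f(z,\frac{w}{q})-f(z,w)}{(\frac1q-1)w}.$$ A complex-valued function $f(z,w)$ of two complex variables, analytic in $z$ and in $w$, is called double $q$-analytic in a region if $\frac12\left(D_q^z+iD_{\frac1q}^w\right)f=0$ holds in the region. *)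

theory Defs
  imports "HOL-Complex_Analysis.Complex_Analysis"
begin

definition q_num :: "complex \<Rightarrow> nat \<Rightarrow> complex" where
  "q_num q n = (q ^ n - 1) / (q - 1)"

definition q_fact :: "complex \<Rightarrow> nat \<Rightarrow> complex" where
  "q_fact q n = (\<Prod>j\<in>{1..n}. q_num q j)"

text \<open>
  A quotient, as usual: it is only meaningful for \<open>k \<le> n\<close> and if none of
  the q-numbers of \<open>1, \<dots>, n\<close> vanishes.
\<close>

definition q_binom :: "complex \<Rightarrow> nat \<Rightarrow> nat \<Rightarrow> complex" where
  "q_binom q n k = q_fact q n / (q_fact q k * q_fact q (n - k))"

definition cq_binomial :: "complex \<Rightarrow> nat \<Rightarrow> complex \<Rightarrow> complex \<Rightarrow> complex" where
  "cq_binomial q n z w = (\<Prod>j<n. z + \<i> * q ^ j * w)"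

text \<open>
  Partial q-derivatives. The difference quotient is 0/0 where the differentiated variable
  vanishes; for an analytic function this singularity is removable, and the value there
  (the limit of the quotient) is the ordinary partial derivative.
\<close>

definition q_deriv_z ::
    "complex \<Rightarrow> (complex \<Rightarrow> complex \<Rightarrow> complex) \<Rightarrow> complex \<Rightarrow> complex \<Rightarrow> complex" where
  "q_deriv_z p f z w =
     (if z = 0 then deriv (\<lambda>u. f u w) 0
      else (f (p * z) w - f z w) / ((p - 1) * z))"

definition q_deriv_w ::
    "complex \<Rightarrow> (complex \<Rightarrow> complex \<Rightarrow> complex) \<Rightarrow> complex \<Rightarrow> complex \<Rightarrow> complex" where
  "q_deriv_w p f z w =
     (if w = 0 then deriv (\<lambda>u. f z u) 0
      else (f z (p * w) - f z w) / ((p - 1) * w))"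

definition double_q_analytic_on ::
    "complex \<Rightarrow> (complex \<Rightarrow> complex \<Rightarrow> complex) \<Rightarrow> (complex \<times> complex) set \<Rightarrow> bool" where
  "double_q_analytic_on q f S \<longleftrightarrow>
     open S \<and> connected S \<and> S \<noteq> {} \<and>
     (\<forall>(z, w)\<in>S.
        (\<lambda>u. f u w) analytic_on {z} \<and>
        (\<lambda>u. f z u) analytic_on {w} \<and>
        1 / 2 * (q_deriv_z q f z w + \<i> * q_deriv_w (1 / q) f z w) = 0)"

end

theory Submission
  imports Defs
begin

text \<open>
  The two factorizations of the product that split off its first or its last factor,
  \<open>(z + i w) \<cdot> (z + i (q w))_q^n\<close> and \<open>(z + i w)_q^n \<cdot> (z + i q^n w)\<close>, carry the proof.
  Replacing \<open>z\<close> by \<open>q z\<close>, or \<open>w\<close> by \<open>w / q\<close>, shifts the factors by one place, so the dilated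
  and the original product of \<open>n + 1\<close> factors share the factor \<open>(z + i w)_q^n\<close> up to a
  power of \<open>q\<close> (\<open>cq_binomial_dilate_z\<close>, \<open>cq_binomial_dilate_w\<close>). What remains of each difference
  is linear, and it gives
  \<open>D_q^z (z + i w)_q^n = [n] (z + i w)_q^(n-1)\<close> and
  \<open>D_(1/q)^w (z + i w)_q^n = i [n] (z + i w)_q^(n-1)\<close>.
  The two terms cancel in the sum of \<open>D_q^z\<close> and \<open>i D_(1/q)^w\<close> because \<open>i^2 = -1\<close>, and they
  add up in the difference.

  On the axes \<open>z = 0\<close> and \<open>w = 0\<close> the q-derivative is an ordinary derivative. Its value is
  obtained by differentiating the same difference identity at the origin
  (\<open>deriv_0_from_dilation\<close>), which therefore yields the same formula there.

  The expansion follows by induction from the q-Pascal rule, which rests on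
  \<open>[a + b] = [a] + q^a [b]\<close>.
\<close>

section \<open>The q-binomial expansion\<close>

lemma q_fact_Suc: "q_fact q (Suc n) = q_fact q n * q_num q (Suc n)"
  by (simp add: q_fact_def)

lemma q_fact_0 [simp]: "q_fact q 0 = 1"
  by (simp add: q_fact_def)

lemma q_fact_nonzero:
  assumes "\<forall>k\<in>{1..n}. q_num q k \<noteq> 0" and "m \<le> n"
  shows "q_fact q m \<noteq> 0"
  using assms by (auto simp: q_fact_def)

lemma q_num_add: "q_num q (a + b) = q_num q a + q ^ a * q_num q b"
  by (simp add: q_num_def power_add add_divide_distrib[symmetric] algebra_simps)

lemma q_binom_0:
  assumes "q_fact q n \<noteq> 0"
  shows "q_binom q n 0 = 1"
  using assms by (simp add: q_binom_def)

lemma q_binom_self: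
  assumes "q_fact q n \<noteq> 0"
  shows "q_binom q n n = 1"
  using assms by (simp add: q_binom_def)

text \<open>
  The restriction \<open>k < n\<close> keeps every q-binomial within its triangle: the quotient that
  defines \<open>q_binom q n k\<close> does not vanish at \<open>k = n + 1\<close>, so the rule fails for \<open>k = n\<close>.
  The expansion therefore treats its first and its last term separately.
\<close>

lemma q_binom_pascal:
  assumes nz: "\<forall>k\<in>{1..Suc n}. q_num q k \<noteq> 0" and "k < n"
  shows "q_binom q (Suc n) (Suc k) = q_binom q n (Suc k) + q ^ (n - k) * q_binom q n k"
proof -
  obtain m where n: "n = Suc (k + m)"
    using \<open>k < n\<close> less_imp_Suc_add by blast
  have split: "q_num q (Suc n) = q_num q (Suc m) + q ^ Suc m * q_num q (Suc k)"
    using q_num_add[of q "Suc m" "Suc k"] by (simp add: n add.commute)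
  have facts: "q_fact q k \<noteq> 0" "q_fact q m \<noteq> 0" "q_num q (Suc k) \<noteq> 0" "q_num q (Suc m) \<noteq> 0"
    using nz q_fact_nonzero[OF nz] by (auto simp: n)
  have diffs: "Suc n - Suc k = Suc m" "n - Suc k = m" "n - k = Suc m"
    by (simp_all add: n)
  show ?thesis
    unfolding q_binom_def diffs q_fact_Suc split
    using facts by (simp add: field_simps)
qed

lemma cq_binomial_0 [simp]: "cq_binomial q 0 z w = 1"
  by (simp add: cq_binomial_def)

lemma cq_binomial_Suc:
  "cq_binomial q (Suc n) z w = cq_binomial q n z w * (z + \<i> * q ^ n * w)"
  by (simp add: cq_binomial_def)

lemma triangular_Suc: "Suc k * (Suc k - 1) div 2 = k * (k - 1) div 2 + k"
proof -
  have "Suc k * (Suc k - 1) = k * (k - 1) + 2 * k"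
    by (cases k) auto
  then show ?thesis
    by simp
qed

lemma cq_binomial_expansion:
  assumes "\<forall>k\<in>{1..n}. q_num q k \<noteq> 0"
  shows "cq_binomial q n z w =
    (\<Sum>k=0..n. q_binom q n k * q ^ (k * (k - 1) div 2) * \<i> ^ k * z ^ (n - k) * w ^ k)"
  using assms
proof (induction n)
  case 0
  show ?case
    by (simp add: q_binom_def)
next
  case (Suc n)
  define t where
    "t n k = q_binom q n k * q ^ (k * (k - 1) div 2) * \<i> ^ k * z ^ (n - k) * w ^ k" for n k
  let ?c = "\<i> * q ^ n * w"
  have fact: "q_fact q n \<noteq> 0" "q_fact q (Suc n) \<noteq> 0"
    using q_fact_nonzero[OF Suc.prems] by simp_all
  have first: "t (Suc n) 0 = t n 0 * z"
    using fact by (simp add: t_def q_binom_0)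
  have last: "t (Suc n) (Suc n) = t n n * ?c"
    using fact unfolding t_def triangular_Suc by (simp add: q_binom_self power_add)
  have middle: "t (Suc n) (Suc k) = t n (Suc k) * z + t n k * ?c" if "k < n" for k
  proof -
    have zpow: "z ^ (n - k) = z ^ (n - Suc k) * z"
      using that by (metis Suc_diff_Suc power_Suc2)
    have qpow: "q ^ n = q ^ (n - k) * q ^ k"
      using that by (simp flip: power_add)
    show ?thesis
      unfolding t_def triangular_Suc q_binom_pascal[OF Suc.prems that] qpow
      by (simp add: zpow power_add algebra_simps)
  qed
  have "cq_binomial q n z w = (\<Sum>k\<le>n. t n k)"
    using Suc by (simp add: t_def atLeast0AtMost)
  then have "cq_binomial q (Suc n) z w = (\<Sum>k\<le>n. t n k) * z + (\<Sum>k\<le>n. t n k) * ?c"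
    by (simp add: cq_binomial_Suc distrib_left)
  also have "(\<Sum>k\<le>n. t n k) * z = (t n 0 + (\<Sum>k<n. t n (Suc k))) * z"
    by (simp add: sum.atMost_shift)
  also have "(\<Sum>k\<le>n. t n k) * ?c = ((\<Sum>k<n. t n k) + t n n) * ?c"
    by (simp flip: lessThan_Suc_atMost)
  also have "(t n 0 + (\<Sum>k<n. t n (Suc k))) * z + ((\<Sum>k<n. t n k) + t n n) * ?c
      = t (Suc n) 0 + (\<Sum>k<n. t (Suc n) (Suc k)) + t (Suc n) (Suc n)"
    by (simp add: first last middle sum.distrib sum_distrib_right distrib_right)
  also have "\<dots> = (\<Sum>k\<le>Suc n. t (Suc n) k)"
    by (simp only: sum.atMost_shift sum.lessThan_Suc add.assoc)
  finally show ?case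
    by (simp add: t_def atLeast0AtMost)
qed

section \<open>The q-derivatives of the complex q-binomial\<close>

lemma cq_binomial_Suc_shift:
  "cq_binomial q (Suc n) z w = (z + \<i> * w) * cq_binomial q n z (q * w)"
  by (simp add: cq_binomial_def prod.lessThan_Suc_shift mult_ac del: prod.lessThan_Suc)

lemma cq_binomial_scale: "cq_binomial q n (c * z) (c * w) = c ^ n * cq_binomial q n z w"
proof -
  have "c * z + \<i> * q ^ j * (c * w) = c * (z + \<i> * q ^ j * w)" for j
    by (simp add: algebra_simps)
  then show ?thesis
    by (simp add: cq_binomial_def prod.distrib)
qed

lemma cq_binomial_dilate_z:
  "cq_binomial q (Suc n) (q * z) w - cq_binomial q (Suc n) z w
     = (q ^ Suc n - 1) * z * cq_binomial q n z w"
proof -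
  have "cq_binomial q (Suc n) (q * z) w = (q * z + \<i> * w) * (q ^ n * cq_binomial q n z w)"
    by (simp only: cq_binomial_Suc_shift cq_binomial_scale)
  then show ?thesis
    by (simp add: cq_binomial_Suc algebra_simps)
qed

lemma cq_binomial_dilate_w:
  assumes "q \<noteq> 0"
  shows "cq_binomial q (Suc n) z (1 / q * w) - cq_binomial q (Suc n) z w
     = (1 / q - q ^ n) * w * (\<i> * cq_binomial q n z w)"
proof -
  have "cq_binomial q (Suc n) z (1 / q * w) = (z + \<i> * (1 / q * w)) * cq_binomial q n z w"
    using assms by (simp add: cq_binomial_Suc_shift)
  then show ?thesis
    by (simp add: cq_binomial_Suc algebra_simps)
qed

text \<open>
  Differentiating the identity at \<open>0\<close> turns its left side into \<open>(p - 1) f' 0\<close>, by the chain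
  rule, and its right side into \<open>(p - 1) g 0\<close>, by the product rule.
\<close>

lemma deriv_0_from_dilation:
  fixes f g :: "complex \<Rightarrow> complex"
  assumes "p \<noteq> 1"
    and f: "f field_differentiable at 0" and g: "g field_differentiable at 0"
    and dilation: "\<And>u. f (p * u) - f u = (p - 1) * u * g u"
  shows "deriv f 0 = g 0"
proof -
  have f': "(f has_field_derivative deriv f 0) (at 0)"
    using f by (simp add: DERIV_deriv_iff_field_differentiable)
  have "((\<lambda>u. f (p * u)) has_field_derivative deriv f 0 * p) (at 0)"
    using f' by (intro DERIV_chain2[where f = f]) (auto intro!: derivative_eq_intros)
  then have "((\<lambda>u. f (p * u) - f u) has_field_derivative deriv f 0 * p - deriv f 0) (at 0)"
    using f' by (rule DERIV_diff)
  moreover have "((\<lambda>u. (p - 1) * u * g u) has_field_derivative (p - 1) * g 0) (at 0)"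
    using g by (auto intro!: derivative_eq_intros simp flip: DERIV_deriv_iff_field_differentiable)
  ultimately have "deriv f 0 * p - deriv f 0 = (p - 1) * g 0"
    unfolding dilation by (rule DERIV_unique)
  then have "(p - 1) * deriv f 0 = (p - 1) * g 0"
    by (simp add: algebra_simps)
  with \<open>p \<noteq> 1\<close> show ?thesis
    by simp
qed

lemma cq_binomial_analytic_z: "(\<lambda>u. cq_binomial q n u w) analytic_on S"
  unfolding cq_binomial_def by (intro analytic_intros)

lemma cq_binomial_analytic_w: "(\<lambda>u. cq_binomial q n z u) analytic_on S"
  unfolding cq_binomial_def by (intro analytic_intros)

lemma q_deriv_z_cq_binomial:
  assumes "q \<noteq> 1"
  shows "q_deriv_z q (cq_binomial q (Suc n)) z w = q_num q (Suc n) * cq_binomial q n z w"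
proof -
  have dilation: "cq_binomial q (Suc n) (q * u) w - cq_binomial q (Suc n) u w
      = (q - 1) * u * (q_num q (Suc n) * cq_binomial q n u w)" for u
    unfolding cq_binomial_dilate_z using assms by (simp add: q_num_def)
  show ?thesis
  proof (cases "z = 0")
    case True
    have "deriv (\<lambda>u. cq_binomial q (Suc n) u w) 0 = q_num q (Suc n) * cq_binomial q n 0 w"
      by (rule deriv_0_from_dilation[OF assms _ _ dilation])
        (intro analytic_on_imp_differentiable_at[where S = UNIV] analytic_intros
          cq_binomial_analytic_z UNIV_I)+
    with True show ?thesis
      by (simp add: q_deriv_z_def)
  next
    case False
    with assms show ?thesis
      by (simp add: q_deriv_z_def dilation)
  qed
qed

lemma q_deriv_w_cq_binomial:
  assumes "q \<noteq> 0" and "q \<noteq> 1"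
  shows "q_deriv_w (1 / q) (cq_binomial q (Suc n)) z w
    = \<i> * (q_num q (Suc n) * cq_binomial q n z w)"
proof -
  have p: "1 / q \<noteq> 1"
    using assms by simp
  have "1 / q - q ^ n = (1 / q - 1) * q_num q (Suc n)"
    using assms by (simp add: q_num_def field_simps)
  then have dilation: "cq_binomial q (Suc n) z (1 / q * u) - cq_binomial q (Suc n) z u
      = (1 / q - 1) * u * (\<i> * (q_num q (Suc n) * cq_binomial q n z u))" for u
    unfolding cq_binomial_dilate_w[OF assms(1)] by (simp only: mult_ac)
  show ?thesis
  proof (cases "w = 0")
    case True
    have "deriv (\<lambda>u. cq_binomial q (Suc n) z u) 0
        = \<i> * (q_num q (Suc n) * cq_binomial q n z 0)"
      by (rule deriv_0_from_dilation[OF p _ _ dilation])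
        (intro analytic_on_imp_differentiable_at[where S = UNIV] analytic_intros
          cq_binomial_analytic_w UNIV_I)+
    with True show ?thesis
      by (simp add: q_deriv_w_def)
  next
    case False
    have "q_deriv_w (1 / q) (cq_binomial q (Suc n)) z w
        = ((1 / q - 1) * w * (\<i> * (q_num q (Suc n) * cq_binomial q n z w))) / ((1 / q - 1) * w)"
      using False by (simp only: q_deriv_w_def dilation if_False)
    with False p show ?thesis
      by (simp only: nonzero_mult_div_cancel_left mult_eq_0_iff right_minus_eq simp_thms)
  qed
qed

section \<open>Double q-analyticity\<close>

theorem mainTheorem3:
  fixes q :: complex and n :: nat
  assumes "q \<noteq> 0" and "q \<noteq> 1" and "n > 0"
  shows "((\<forall>k\<in>{1..n}. q_num q k \<noteq> 0) \<longrightarrow>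
            (\<forall>z w. cq_binomial q n z w =
              (\<Sum>k=0..n. q_binom q n k * q ^ (k * (k - 1) div 2) * \<i> ^ k * z ^ (n - k) * w ^ k)))
       \<and> (\<forall>z w. 1 / 2 * (q_deriv_z q (cq_binomial q n) z w
                        + \<i> * q_deriv_w (1 / q) (cq_binomial q n) z w) = 0)
       \<and> double_q_analytic_on q (cq_binomial q n) UNIV
       \<and> (\<forall>z w. 1 / 2 * (q_deriv_z q (cq_binomial q n) z w
                        - \<i> * q_deriv_w (1 / q) (cq_binomial q n) z w)
                = q_num q n * cq_binomial q (n - 1) z w)"
proof -
  obtain m where n: "n = Suc m"
    using \<open>n > 0\<close> gr0_conv_Suc by blast
  have dz: "q_deriv_z q (cq_binomial q n) z w = q_num q n * cq_binomial q (n - 1) z w" for z w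
    using q_deriv_z_cq_binomial[OF \<open>q \<noteq> 1\<close>] by (simp add: n)
  have dw: "q_deriv_w (1 / q) (cq_binomial q n) z w
      = \<i> * (q_num q n * cq_binomial q (n - 1) z w)" for z w
    using q_deriv_w_cq_binomial[OF \<open>q \<noteq> 0\<close> \<open>q \<noteq> 1\<close>] by (simp add: n)
  have kernel: "1 / 2 * (q_deriv_z q (cq_binomial q n) z w
      + \<i> * q_deriv_w (1 / q) (cq_binomial q n) z w) = 0" for z w
    unfolding dz dw by simp
  have derivative: "1 / 2 * (q_deriv_z q (cq_binomial q n) z w
      - \<i> * q_deriv_w (1 / q) (cq_binomial q n) z w)
      = q_num q n * cq_binomial q (n - 1) z w" for z w
    unfolding dz dw by simp
  have "double_q_analytic_on q (cq_binomial q n) UNIV"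
    unfolding double_q_analytic_on_def
    using kernel cq_binomial_analytic_z cq_binomial_analytic_w by auto
  with kernel derivative cq_binomial_expansion show ?thesis
    by blast
qed

end
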